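(* Let $L_f>0$ and let $f\colon\mathcal H\to\mathbb R$ be convex, Fréchet differentiable and $L_f$-smooth. Let $(C_i)_{i\in I}$ be a finite collection of nonempty compact convex subsets of $\mathcal H$ with diameters $\{R_i\}_{i\in I}\subset[0,+\infty[$ such that $\bigcap_{i\in I}C_i\ne\varnothing$. For every $\lambda\ge0$, set $F_\lambda\colon\boldsymbol{\mathcal H}\to\left]-\infty,+\infty\right]\colon\boldsymbol x\mapsto f(A\boldsymbol x)+\frac\lambda2\operatorname{dist}_{\boldsymbol D}^2(\boldsymbol x)$. For every $t\ge0$ set $\gamma_t=2/(\sqrt t+2)$; let $\lambda_0>0$ and, for every $t\ge0$, set $\lambda_{t+1}=\lambda_t+\lambda_0(\sqrt t+2)^{-2}$. Let $(\boldsymbol x_t)_{t\in\mathbb N}$ be the iterates of the split conditional gradient algorithm (described in the context) with these parameters. For every $t\in\mathbb N$, let $\boldsymbol x_t^*\in\operatorname{Argmin}_{\boldsymbol x\in\prod_{i\in I}C_i}F_{\lambda_t}(\boldsymbol x)$ and set $H_t=F_{\lambda_t}(\boldsymbol x_t)-F_{\lambda_t}(\boldsymbol x_t^* )$. Then, for every $t\in\mathbb N$, $$0\le H_t\le 2\sum_{i\in I}\omega_iR_i^2\left(\frac{\lambda_0\left(2\ln(\sqrt t+2)+\frac14\right)+L_f}{\sqrt t+2}+\frac{4\lambda_0}{(\sqrt t+2)^2}\right).$$ In particular, $F_{\lambda_t}(\boldsymbol x_t)\to\inf_{x\in\bigcap_{i\in I}C_i}f(x)$ and $\operatorname{dist}_{\boldsymbol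 D}(\boldsymbol x_t)\to0$ as $t\to\infty$. Furthermore, every accumulation point $\boldsymbol x_\infty$ of $(\boldsymbol x_t)_{t\in\mathbb N}$ produces a solution $A\boldsymbol x_\infty\in\bigcap_{i\in I}C_i$ such that $f(A\boldsymbol x_\infty)=\inf_{x\in\bigcap_{i\in I}C_i}f(x)$.
   Context: $\mathcal H$ is a real Hilbert space with inner product $\langle\cdot\mid\cdot\rangle$ and norm $\|\cdot\|$; $\mathbb N=\{0,1,2,\dots\}$. $m\ge1$ is an integer, $I=\{1,\dots,m\}$, and $\{\omega_i\}_{i\in I}\subset\left]0,1\right]$ satisfies $\sum_{i\in I}\omega_i=1$. $\boldsymbol{\mathcal H}=\mathcal H^m$ is the real Hilbert space with inner product $\langle\boldsymbol x\mid\boldsymbol y\rangle_{\boldsymbol{\mathcal H}}=\sum_{i\in I}\omega_i\langle\boldsymbol x^i\mid\boldsymbol y^i\rangle$, where $\boldsymbol x=(\boldsymbol x^1,\dots,\boldsymbol x^m)$, and with the induced norm. $\boldsymbol D=\{\boldsymbol x\in\boldsymbol{\mathcal H}:\boldsymbol x^1=\dots=\boldsymbol x^m\}$ is the diagonal subspace, and $\operatorname{dist}_{\boldsymbol D}(\boldsymbol x)=\inf_{\boldsymbol z\in\boldsymbol D}\|\boldsymbol x-\boldsymbol z\|_{\boldsymbol{\mathcal H}}$. $A\colon\boldsymbol{\mathcal H}\to\mathcal H\colon\boldsymbol x\mapsto\sum_{i\in I}\omega_i\boldsymbol x^i$ is the averaging operator. $\prod_{i\in I}C_i=C_1\times\dots\times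 C_m\subset\boldsymbol{\mathcal H}$. $f$ is $L_f$-smooth if $f(y)-f(x)\le\langle\nabla f(x)\mid y-x\rangle+\frac{L_f}{2}\|y-x\|^2$ for all $x,y\in\mathcal H$. For $i\in I$ and $x\in\mathcal H$, $\operatorname{LMO}_i(x)$ denotes a point in $\operatorname{Argmin}_{z\in C_i}\langle x\mid z\rangle$ (any selection). Split conditional gradient algorithm, with penalty parameters $\lambda_t\in\left]0,+\infty\right[$ and step sizes $\gamma_t\in\left]0,1\right]$: start from any $\boldsymbol x_0\in\prod_{i\in I}C_i$ and set $x_0=\sum_{i\in I}\omega_i\boldsymbol x_0^i$. For $t=0,1,2,\dots$: set $g_t=\nabla f(x_t)$; for every $i\in I$ set $\boldsymbol v_t^i=\operatorname{LMO}_i(g_t+\lambda_t(\boldsymbol x_t^i-x_t))$ and $\boldsymbol x_{t+1}^i=\boldsymbol x_t^i+\gamma_t(\boldsymbol v_t^i-\boldsymbol x_t^i)$; then set $x_{t+1}=\sum_{i\in I}\omega_i\boldsymbol x_{t+1}^i$. The iterates are $\boldsymbol x_t=(\boldsymbol x_t^1,\dots,\boldsymbol x_t^m)$, so $x_t=A\boldsymbol x_t$.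
   Formalization: The upper bound on H_t is stated only for t ≥ 1, since at t = 0 it is false: for m = 1, C_1 = [0,1], f(x) = 100x, L_f = λ_0 = 1, x_0 = 1 one has H_0 = 100 but a bound below 5. That 0 ≤ H_t is kept for all t. *)

theory Defs
  imports "HOL-Analysis.Analysis"
begin

text \<open>
  The index set \<open>I\<close> is a finite type \<open>'i\<close>, and \<open>\<H>\<^sup>m\<close> is the type \<open>'a ^ 'i\<close>. The library inner product
  and norm of \<open>'a ^ 'i\<close> are the unweighted ones, so the weighted ones are defined here; every
  metric notion on the product space below refers to \<open>wnorm \<omega>\<close>.
\<close>

definition winner :: "('i::finite \<Rightarrow> real) \<Rightarrow> 'a::real_inner ^ 'i \<Rightarrow> 'a ^ 'i \<Rightarrow> real" where
  "winner \<omega> x y = (\<Sum>i\<in>UNIV. \<omega> i * inner (x $ i) (y $ i))"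

definition wnorm :: "('i::finite \<Rightarrow> real) \<Rightarrow> 'a::real_inner ^ 'i \<Rightarrow> real" where
  "wnorm \<omega> x = sqrt (winner \<omega> x x)"

definition diagonal :: "('a ^ 'i::finite) set" where
  "diagonal = {x. \<forall>i j. x $ i = x $ j}"

definition dist_diagonal :: "('i::finite \<Rightarrow> real) \<Rightarrow> 'a::real_inner ^ 'i \<Rightarrow> real" where
  "dist_diagonal \<omega> x = (INF z\<in>diagonal. wnorm \<omega> (x - z))"

definition average :: "('i::finite \<Rightarrow> real) \<Rightarrow> 'a::real_inner ^ 'i \<Rightarrow> 'a" where
  "average \<omega> x = (\<Sum>i\<in>UNIV. \<omega> i *\<^sub>R x $ i)"

definition prod_set :: "('i::finite \<Rightarrow> 'a set) \<Rightarrow> ('a ^ 'i) set" where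
  "prod_set C = {x. \<forall>i. x $ i \<in> C i}"

text \<open>
  The gradient is the Riesz representative of the Frechet derivative; in a Hilbert space it exists
  and is unique wherever the function is differentiable.
\<close>

definition gradient :: "('a::real_inner \<Rightarrow> real) \<Rightarrow> 'a \<Rightarrow> 'a" where
  "gradient f x = (THE g. GDERIV f x :> g)"

definition smooth_with :: "real \<Rightarrow> ('a::real_inner \<Rightarrow> real) \<Rightarrow> bool" where
  "smooth_with L f \<longleftrightarrow>
     (\<forall>x y. f y - f x \<le> inner (gradient f x) (y - x) + L / 2 * (norm (y - x))\<^sup>2)"

definition penalized ::
    "('i::finite \<Rightarrow> real) \<Rightarrow> ('a::real_inner \<Rightarrow> real) \<Rightarrow> real \<Rightarrow> 'a ^ 'i \<Rightarrow> real" where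
  "penalized \<omega> f lam x = f (average \<omega> x) + lam / 2 * (dist_diagonal \<omega> x)\<^sup>2"

text \<open>
  A sequence of iterates of the split conditional gradient algorithm. The point \<open>v\<close> is the one
  returned by the linear minimization oracle of \<open>C i\<close>; it may be any minimizer, and the choice
  may depend on \<open>t\<close>.
\<close>

definition split_cg ::
    "('i::finite \<Rightarrow> real) \<Rightarrow> ('i \<Rightarrow> 'a::real_inner set) \<Rightarrow> ('a \<Rightarrow> real) \<Rightarrow>
     (nat \<Rightarrow> real) \<Rightarrow> (nat \<Rightarrow> real) \<Rightarrow> (nat \<Rightarrow> 'a ^ 'i) \<Rightarrow> bool" where
  "split_cg \<omega> C f lam \<gamma> X \<longleftrightarrow>
     X 0 \<in> prod_set C \<and>
     (\<forall>t i. \<exists>v.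
        is_arg_min
          (inner (gradient f (average \<omega> (X t)) + lam t *\<^sub>R (X t $ i - average \<omega> (X t))))
          (\<lambda>z. z \<in> C i) v \<and>
        X (Suc t) $ i = X t $ i + \<gamma> t *\<^sub>R (v - X t $ i))"

definition accumulation_point ::
    "('i::finite \<Rightarrow> real) \<Rightarrow> (nat \<Rightarrow> 'a::real_inner ^ 'i) \<Rightarrow> 'a ^ 'i \<Rightarrow> bool" where
  "accumulation_point \<omega> X z \<longleftrightarrow>
     (\<exists>r::nat \<Rightarrow> nat. strict_mono r \<and> (\<lambda>k. wnorm \<omega> (X (r k) - z)) \<longlonglongrightarrow> 0)"

end

theory Submission
  imports Defs "HOL-Real_Asymp.Real_Asymp"
begin

text \<open>
  The squared distance to the diagonal is the weighted variance of the components, a quadratic form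
  whose Taylor expansion is exact. Hence \<open>penalized \<omega> f lam\<close> is convex and
  \<open>(L + lam)\<close>-smooth for the weighted norm (\<open>penalized_lower\<close>,
  \<open>penalized_upper\<close>), with gradient components
  \<open>\<nabla>f (average x) + lam (x\<^sup>i - average x)\<close>. These are exactly the vectors handed to the
  linear minimization oracles, so the algorithm is the conditional gradient method on the product
  set, applied to an objective whose penalty grows with \<open>t\<close>.

  The proof follows the gap \<open>H\<^sub>t\<close> between the penalized value of the iterate and the infimum over
  the product set. One step contracts it by \<open>1 - \<gamma>\<^sub>t\<close> and adds two errors of order
  \<open>s\<^sup>-\<^sup>2\<close>, up to the size of the penalty, where \<open>s = sqrt t + 2\<close>: the
  curvature term, and the cost of raising the penalty, which is controlled because an iterate is
  never farther from the diagonal than the weighted diameter of the product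
  (\<open>gap_recurrence\<close>). Raising the penalty can only raise the infimum, which helps. The
  increments \<open>\<lambda>\<^sub>0 / s\<^sup>2\<close> sum to at most \<open>2 \<lambda>\<^sub>0 ln s\<close> (\<open>penalty_le_ln\<close>),
  and with \<open>B\<^sub>t = \<lambda>\<^sub>0 (2 ln s + 1/4) + L\<close> and \<open>D\<close> the sum of the
  \<open>\<omega>\<^sub>i R\<^sub>i\<^sup>2\<close>, the recurrence reads
  \<open>H\<^sub>t\<^sub>+\<^sub>1 \<le> (1 - 2/s) H\<^sub>t + 2 D B\<^sub>t / s\<^sup>2\<close>. Since \<open>(s - 1) / s\<^sup>2 \<le> 1 / (s + 1)\<close> and
  \<open>s\<close> grows by at most 1 per step, it preserves the bound \<open>H\<^sub>t \<le> 2 D B\<^sub>t / s\<close>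
  (\<open>gap_bound\<close>). The first step size is 1, which erases the arbitrary initial gap and starts
  the induction at \<open>t = 1\<close>.

  The same increments are of order \<open>1 / t\<close>, so the penalty tends to infinity
  (\<open>penalty_at_top\<close>). The infimum of the penalized problem never exceeds the optimal value
  of the original one, and \<open>f\<close> is bounded below on the averages, so the penalty term stays
  bounded and the distance to the diagonal must vanish. A limit of one component along a
  subsequence is then a limit of all of them; it therefore lies in every \<open>C i\<close>
  (\<open>cluster_feasible\<close>). Compactness and continuity of \<open>f\<close> thus yield the lower
  half of the convergence of the values, and the vanishing gap yields the upper half.
\<close>


section \<open>Weighted averages and the distance to the diagonal\<close>

locale weights =
  fixes \<omega> :: "'i::finite \<Rightarrow> real"
  assumes weight_pos: "0 < \<omega> i"
    and sum_weights: "(\<Sum>i\<in>UNIV. \<omega> i) = 1"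
begin

lemma weight_nonneg: "0 \<le> \<omega> i"
  using weight_pos[of i] by simp

lemma average_diff:
  fixes x y :: "'a::real_inner ^ 'i"
  shows "average \<omega> (y - x) = average \<omega> y - average \<omega> x"
  by (simp add: average_def scaleR_diff_right sum_subtractf)

lemma inner_average:
  fixes x :: "'a::real_inner ^ 'i"
  shows "inner c (average \<omega> x) = (\<Sum>i\<in>UNIV. \<omega> i * inner c (x $ i))"
  by (simp add: average_def inner_sum_right)

lemma average_diagonal:
  fixes c :: "'a::real_inner"
  shows "average \<omega> (\<chi> i. c) = c"
  by (simp add: average_def scaleR_left.sum[symmetric] sum_weights)

lemma sum_weighted_const: "(\<Sum>i\<in>UNIV. \<omega> i * c) = c"
  by (simp add: sum_distrib_right[symmetric] sum_weights)

lemma centered_inner_sum: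
  fixes x :: "'a::real_inner ^ 'i"
  shows "(\<Sum>i\<in>UNIV. \<omega> i * inner (x $ i - average \<omega> x) c) = 0"
proof -
  have "(\<Sum>i\<in>UNIV. \<omega> i * inner (x $ i - average \<omega> x) c)
      = (\<Sum>i\<in>UNIV. \<omega> i * inner c (x $ i)) - (\<Sum>i\<in>UNIV. \<omega> i * inner c (average \<omega> x))"
    unfolding inner_commute[of _ c]
    by (simp only: inner_diff_right right_diff_distrib sum_subtractf)
  then show ?thesis
    by (simp add: inner_average[symmetric] sum_weighted_const)
qed

text \<open>
  The deviations from the average are orthogonal to the diagonal, so this is the Pythagorean
  theorem for the projection onto the diagonal.
\<close>

lemma weighted_pythagoras:
  fixes x :: "'a::real_inner ^ 'i"
  shows "(\<Sum>i\<in>UNIV. \<omega> i * (norm (x $ i - c))\<^sup>2)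
    = (\<Sum>i\<in>UNIV. \<omega> i * (norm (x $ i - average \<omega> x))\<^sup>2) + (norm (average \<omega> x - c))\<^sup>2"
proof -
  let ?a = "average \<omega> x"
  have "(norm (x $ i - c))\<^sup>2
      = (norm (x $ i - ?a))\<^sup>2 + 2 * inner (x $ i - ?a) (?a - c) + (norm (?a - c))\<^sup>2" for i
    by (simp add: power2_norm_eq_inner algebra_simps inner_commute)
  then have "(\<Sum>i\<in>UNIV. \<omega> i * (norm (x $ i - c))\<^sup>2)
      = (\<Sum>i\<in>UNIV. \<omega> i * (norm (x $ i - ?a))\<^sup>2)
        + 2 * (\<Sum>i\<in>UNIV. \<omega> i * inner (x $ i - ?a) (?a - c))
        + (\<Sum>i\<in>UNIV. \<omega> i * (norm (?a - c))\<^sup>2)"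
    by (simp add: distrib_left sum.distrib sum_distrib_left mult.left_commute)
  then show ?thesis
    by (simp only: centered_inner_sum sum_weighted_const)
qed

lemma wnorm_eq: "wnorm \<omega> x = sqrt (\<Sum>i\<in>UNIV. \<omega> i * (norm (x $ i))\<^sup>2)"
  by (simp add: wnorm_def winner_def power2_norm_eq_inner)

lemma dist_diagonal_eq:
  fixes x :: "'a::real_inner ^ 'i"
  shows "dist_diagonal \<omega> x = sqrt (\<Sum>i\<in>UNIV. \<omega> i * (norm (x $ i - average \<omega> x))\<^sup>2)"
  unfolding dist_diagonal_def
proof (rule cInf_eq_minimum)
  show "sqrt (\<Sum>i\<in>UNIV. \<omega> i * (norm (x $ i - average \<omega> x))\<^sup>2)
      \<in> (\<lambda>z. wnorm \<omega> (x - z)) ` diagonal"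
    by (rule image_eqI[of _ _ "\<chi> i. average \<omega> x"]) (auto simp: wnorm_eq diagonal_def)
next
  fix r assume "r \<in> (\<lambda>z. wnorm \<omega> (x - z)) ` diagonal"
  then obtain z :: "'a ^ 'i" where z: "z \<in> diagonal" and r: "r = wnorm \<omega> (x - z)" by auto
  obtain c where "\<And>i. z $ i = c" using z unfolding diagonal_def by blast
  then have "r = sqrt (\<Sum>i\<in>UNIV. \<omega> i * (norm (x $ i - c))\<^sup>2)"
    by (simp add: r wnorm_eq)
  then show "sqrt (\<Sum>i\<in>UNIV. \<omega> i * (norm (x $ i - average \<omega> x))\<^sup>2) \<le> r"
    by (simp add: weighted_pythagoras[of x c])
qed

lemma dist_diagonal_sq:
  fixes x :: "'a::real_inner ^ 'i"
  shows "(dist_diagonal \<omega> x)\<^sup>2 = (\<Sum>i\<in>UNIV. \<omega> i * (norm (x $ i - average \<omega> x))\<^sup>2)"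
  by (simp add: dist_diagonal_eq sum_nonneg weight_nonneg)

lemma dist_diagonal_nonneg:
  fixes x :: "'a::real_inner ^ 'i"
  shows "0 \<le> dist_diagonal \<omega> x"
  by (simp add: dist_diagonal_eq sum_nonneg weight_nonneg)

lemma dist_diagonal_constant:
  fixes c :: "'a::real_inner"
  shows "dist_diagonal \<omega> (\<chi> i. c) = 0"
  by (simp add: dist_diagonal_eq average_diagonal)

lemma dist_diagonal_sq_plus_average:
  fixes x :: "'a::real_inner ^ 'i"
  shows "(\<Sum>i\<in>UNIV. \<omega> i * (norm (x $ i - c))\<^sup>2) = (dist_diagonal \<omega> x)\<^sup>2 + (norm (average \<omega> x - c))\<^sup>2"
  by (simp only: dist_diagonal_sq weighted_pythagoras[of x c])

lemma component_deviation_le: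
  fixes x :: "'a::real_inner ^ 'i"
  shows "norm (x $ i - average \<omega> x) \<le> dist_diagonal \<omega> x / sqrt (\<omega> i)"
proof -
  have "\<omega> i * (norm (x $ i - average \<omega> x))\<^sup>2 \<le> (dist_diagonal \<omega> x)\<^sup>2"
    unfolding dist_diagonal_sq
    by (rule member_le_sum[where f="\<lambda>i. \<omega> i * (norm (x $ i - average \<omega> x))\<^sup>2"])
       (simp_all add: weight_nonneg)
  then have "sqrt (\<omega> i * (norm (x $ i - average \<omega> x))\<^sup>2) \<le> dist_diagonal \<omega> x"
    using dist_diagonal_nonneg[of x] real_le_lsqrt by (simp add: real_le_lsqrt)
  then show ?thesis
    using weight_pos[of i] by (simp add: real_sqrt_mult field_simps)
qed

lemma component_le_wnorm:
  fixes x :: "'a::real_inner ^ 'i"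
  shows "norm (x $ i) \<le> wnorm \<omega> x / sqrt (\<omega> i)"
proof -
  have "\<omega> i * (norm (x $ i))\<^sup>2 \<le> (\<Sum>i\<in>UNIV. \<omega> i * (norm (x $ i))\<^sup>2)"
    by (rule member_le_sum[where f="\<lambda>i. \<omega> i * (norm (x $ i))\<^sup>2"]) (simp_all add: weight_nonneg)
  then have "sqrt (\<omega> i * (norm (x $ i))\<^sup>2) \<le> wnorm \<omega> x"
    unfolding wnorm_eq by (rule real_sqrt_le_mono)
  then show ?thesis
    using weight_pos[of i] by (simp add: real_sqrt_mult field_simps)
qed

text \<open>
  The gradient of \<open>x \<mapsto> dist_diagonal \<omega> x ^ 2 / 2\<close> in the weighted inner product has the
  components \<open>x\<^sup>i - average x\<close>; the average of \<open>y - x\<close> drops out of the linear term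
  because the deviations sum to zero.
\<close>

lemma dist_diagonal_sq_expand:
  fixes x y :: "'a::real_inner ^ 'i"
  shows "(dist_diagonal \<omega> y)\<^sup>2 = (dist_diagonal \<omega> x)\<^sup>2
    + 2 * (\<Sum>i\<in>UNIV. \<omega> i * inner (x $ i - average \<omega> x) (y $ i - x $ i))
    + (dist_diagonal \<omega> (y - x))\<^sup>2"
proof -
  let ?a = "average \<omega> x" and ?d = "average \<omega> (y - x)"
  have "(norm (y $ i - average \<omega> y))\<^sup>2
      = (norm (x $ i - ?a))\<^sup>2 + 2 * inner (x $ i - ?a) (y $ i - x $ i)
        - 2 * inner (x $ i - ?a) ?d + (norm ((y - x) $ i - ?d))\<^sup>2" for i
    by (simp add: average_diff power2_norm_eq_inner algebra_simps inner_commute)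
  then have "(dist_diagonal \<omega> y)\<^sup>2 = (dist_diagonal \<omega> x)\<^sup>2
      + 2 * (\<Sum>i\<in>UNIV. \<omega> i * inner (x $ i - ?a) (y $ i - x $ i))
      - 2 * (\<Sum>i\<in>UNIV. \<omega> i * inner (x $ i - ?a) ?d)
      + (dist_diagonal \<omega> (y - x))\<^sup>2"
    unfolding dist_diagonal_sq
    by (simp add: distrib_left right_diff_distrib sum.distrib sum_subtractf sum_distrib_left
        mult.left_commute)
  then show ?thesis
    by (simp only: centered_inner_sum)
qed

end

section \<open>First-order estimates for the penalized objective\<close>

text \<open>
  Extending the segment from \<open>y\<close> to \<open>x\<close> slightly beyond \<open>x\<close> turns the quadratic upper bound into the gradient
  inequality: with \<open>z = x - s (y - x)\<close>, convexity bounds \<open>f y\<close> from below by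
  \<open>f x\<close> and \<open>f z\<close>, smoothness bounds \<open>f z\<close> from above, and the quadratic term
  disappears as \<open>s\<close> tends to 0.
\<close>

lemma gradient_inequality:
  fixes f :: "'a::real_inner \<Rightarrow> real"
  assumes "convex_on UNIV f" and "smooth_with L f"
  shows "f x + inner (gradient f x) (y - x) \<le> f y"
proof -
  let ?g = "inner (gradient f x) (y - x)" and ?q = "(norm (y - x))\<^sup>2"
  have *: "f x + ?g \<le> f y + L / 2 * s * ?q" if s: "0 < s" for s :: real
  proof -
    let ?z = "x - s *\<^sub>R (y - x)"
    have conv: "f ((1 / (1 + s)) *\<^sub>R ?z + (s / (1 + s)) *\<^sub>R y)
        \<le> 1 / (1 + s) * f ?z + s / (1 + s) * f y"
    proof -
      have "1 - s / (1 + s) = 1 / (1 + s)" using s by (simp add: field_simps)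
      then show ?thesis using convex_onD[OF assms(1), of "s / (1 + s)" ?z y] s by simp
    qed
    have "(1 / (1 + s)) *\<^sub>R ?z + (s / (1 + s)) *\<^sub>R y = (1 / (1 + s)) *\<^sub>R ((1 + s) *\<^sub>R x)"
      by (simp add: algebra_simps)
    then have "(1 / (1 + s)) *\<^sub>R ?z + (s / (1 + s)) *\<^sub>R y = x" using s by simp
    with conv have "f x \<le> (f ?z + s * f y) / (1 + s)" by (simp add: add_divide_distrib)
    then have 1: "(1 + s) * f x \<le> f ?z + s * f y" using s by (simp add: field_simps)
    have "f ?z - f x \<le> inner (gradient f x) (?z - x) + L / 2 * (norm (?z - x))\<^sup>2"
      using assms(2) unfolding smooth_with_def by blast
    then have "f ?z - f x \<le> - s * ?g + L / 2 * (s\<^sup>2 * ?q)"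
      by (simp add: power_mult_distrib inner_diff_right)
    with 1 have "s * (f x + ?g) \<le> s * (f y + L / 2 * s * ?q)"
      by (simp add: algebra_simps power2_eq_square)
    then show ?thesis using s by simp
  qed
  have "((\<lambda>s. f y + L / 2 * s * ?q) \<longlongrightarrow> f y + L / 2 * 0 * ?q) (at_right 0)"
    by (intro tendsto_intros)
  then have "f x + ?g \<le> f y + L / 2 * 0 * ?q"
    by (rule tendsto_lowerbound) (rule eventually_mono[OF eventually_at_right_less *], simp_all)
  then show ?thesis by simp
qed

context weights
begin

lemma penalized_gradient_inner:
  fixes x y :: "'a::real_inner ^ 'i"
  shows "(\<Sum>i\<in>UNIV. \<omega> i * inner (g + lam *\<^sub>R (x $ i - average \<omega> x)) (y $ i - x $ i))
    = inner g (average \<omega> y - average \<omega> x)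
      + lam * (\<Sum>i\<in>UNIV. \<omega> i * inner (x $ i - average \<omega> x) (y $ i - x $ i))"
  unfolding average_diff[symmetric] inner_average
  by (simp add: inner_add_left distrib_left sum.distrib sum_distrib_left mult.left_commute)

text \<open>
  The exact expansion of the squared distance ends with a square, so the penalty also lies above
  its linearization.
\<close>

lemma penalized_lower:
  fixes f :: "'a::real_inner \<Rightarrow> real" and x y :: "'a ^ 'i"
  assumes "convex_on UNIV f" and "smooth_with L f" and "0 \<le> lam"
  shows "penalized \<omega> f lam x + (\<Sum>i\<in>UNIV. \<omega> i *
      inner (gradient f (average \<omega> x) + lam *\<^sub>R (x $ i - average \<omega> x)) (y $ i - x $ i))
    \<le> penalized \<omega> f lam y"
proof -
  have "f (average \<omega> x) + inner (gradient f (average \<omega> x)) (average \<omega> y - average \<omega> x)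
      \<le> f (average \<omega> y)"
    by (rule gradient_inequality[OF assms(1,2)])
  moreover have "0 \<le> lam / 2 * (dist_diagonal \<omega> (y - x))\<^sup>2" using assms(3) by simp
  ultimately show ?thesis
    unfolding penalized_gradient_inner penalized_def dist_diagonal_sq_expand[of y x]
    by (simp add: algebra_simps)
qed

text \<open>
  By \<open>weighted_pythagoras\<close> at 0, both the averaging operator and the distance to the
  diagonal are nonexpansive at the origin for the weighted norm, so the moduli \<open>L\<close> and
  \<open>lam\<close> add up.
\<close>

lemma penalized_upper:
  fixes f :: "'a::real_inner \<Rightarrow> real" and x y :: "'a ^ 'i"
  assumes "smooth_with L f" and "0 \<le> L" and "0 \<le> lam"
  shows "penalized \<omega> f lam y \<le> penalized \<omega> f lam x
    + (\<Sum>i\<in>UNIV. \<omega> i *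
        inner (gradient f (average \<omega> x) + lam *\<^sub>R (x $ i - average \<omega> x)) (y $ i - x $ i))
    + (L + lam) / 2 * (\<Sum>i\<in>UNIV. \<omega> i * (norm (y $ i - x $ i))\<^sup>2)"
proof -
  let ?S = "\<Sum>i\<in>UNIV. \<omega> i * (norm (y $ i - x $ i))\<^sup>2"
  have S: "?S = (dist_diagonal \<omega> (y - x))\<^sup>2 + (norm (average \<omega> (y - x)))\<^sup>2"
    using dist_diagonal_sq_plus_average[of "y - x" 0] by simp
  have "f (average \<omega> y) - f (average \<omega> x)
      \<le> inner (gradient f (average \<omega> x)) (average \<omega> y - average \<omega> x)
        + L / 2 * (norm (average \<omega> (y - x)))\<^sup>2"
    using assms(1) unfolding smooth_with_def average_diff by blast
  moreover have "L / 2 * (norm (average \<omega> (y - x)))\<^sup>2 \<le> L / 2 * ?S"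
    using assms(2) S by (intro mult_left_mono) auto
  moreover have "lam / 2 * (dist_diagonal \<omega> (y - x))\<^sup>2 \<le> lam / 2 * ?S"
    using assms(3) S by (intro mult_left_mono) auto
  ultimately show ?thesis
    unfolding penalized_gradient_inner penalized_def dist_diagonal_sq_expand[of y x]
    by (simp add: algebra_simps add_divide_distrib)
qed

end

section \<open>Growth of the penalty parameter\<close>

text \<open>
  The function \<open>2 ln (sqrt u + 2)\<close> has derivative \<open>1 / (sqrt u (sqrt u + 2))\<close>, which
  dominates the increment \<open>1 / (sqrt t + 2)\<^sup>2\<close> on the interval from \<open>t\<close> to
  \<open>t + 1\<close>, since there \<open>sqrt u\<close> is at most \<open>sqrt t + 1\<close>.
\<close>

lemma penalty_le_ln:
  fixes lam :: "nat \<Rightarrow> real"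
  assumes "0 \<le> lam 0"
    and "\<And>t. lam (Suc t) = lam t + lam 0 / (sqrt (real t) + 2)\<^sup>2"
  shows "lam t \<le> 2 * lam 0 * ln (sqrt (real t) + 2)"
proof (induction t)
  case 0
  have "1 - 1 / 2 \<le> ln (2::real)" using ln_le_minus_one[of "1/2::real"] by (simp add: ln_div)
  then have "lam 0 * 1 \<le> lam 0 * (2 * ln 2)" using assms(1) by (intro mult_left_mono) auto
  then show ?case by simp
next
  case (Suc t)
  define a where "a = sqrt (real t)"
  define b where "b = sqrt (real (Suc t))"
  have a: "0 \<le> a" "0 < b" "a \<le> b" "b\<^sup>2 = a\<^sup>2 + 1" by (auto simp: a_def b_def)
  have ba: "b \<le> a + 1" by (rule power2_le_imp_le) (use a in \<open>auto simp: power2_sum\<close>)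
  have "(b - a) * (b + a) = 1" using a by (simp add: algebra_simps power2_eq_square)
  then have diff: "b - a = 1 / (b + a)" using a by (simp add: field_simps)
  have "(b + a) * (b + 2) \<le> (2 * b) * (b + 2)" using a by (intro mult_right_mono) auto
  also have "\<dots> = 2 * (a\<^sup>2 + 1 + 2 * b)" using a(4) by (simp add: power2_eq_square algebra_simps)
  also have "\<dots> \<le> 2 * (a + 2)\<^sup>2" using ba a by (simp add: power2_eq_square algebra_simps)
  \<comment> \<open>Since \<open>b - a = 1 / (b + a)\<close>, the right-hand side is twice \<open>(b - a) / (b + 2)\<close>.\<close>
  finally have "2 / (2 * (a + 2)\<^sup>2) \<le> 2 / ((b + a) * (b + 2))"
    using a by (intro divide_left_mono) (auto intro!: mult_pos_pos add_pos_nonneg)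
  also have "\<dots> = 2 * (1 - (a + 2) / (b + 2))"
  proof -
    have "1 - (a + 2) / (b + 2) = (b - a) / (b + 2)" using a by (simp add: field_simps)
    then show ?thesis unfolding diff by simp
  qed
  also have "\<dots> \<le> 2 * (ln (b + 2) - ln (a + 2))"
  proof -
    define q where "q = (a + 2) / (b + 2)"
    have "ln q \<le> q - 1" using a by (intro ln_le_minus_one) (simp add: q_def)
    then have "1 - q \<le> - ln q" by linarith
    also have "- ln q = ln (b + 2) - ln (a + 2)" using a by (simp add: q_def ln_div)
    finally show ?thesis unfolding q_def[symmetric] by (rule mult_left_mono) simp
  qed
  finally have "1 / (a + 2)\<^sup>2 \<le> 2 * (ln (b + 2) - ln (a + 2))" by simp
  then have "lam 0 * (1 / (a + 2)\<^sup>2) \<le> lam 0 * (2 * (ln (b + 2) - ln (a + 2)))"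
    using assms(1) by (rule mult_left_mono)
  with Suc.IH show ?case
    using assms(2)[of t] unfolding a_def[symmetric] b_def[symmetric] by (simp add: algebra_simps)
qed

text \<open>
  Since \<open>(sqrt t + 2)\<^sup>2 \<le> 9 (t + 1)\<close>, the increments dominate a multiple of the harmonic
  series.
\<close>

lemma penalty_at_top:
  fixes lam :: "nat \<Rightarrow> real"
  assumes "0 < lam 0"
    and "\<And>t. lam (Suc t) = lam t + lam 0 / (sqrt (real t) + 2)\<^sup>2"
  shows "filterlim lam at_top sequentially"
proof (rule filterlim_at_top_mono)
  have low: "lam 0 / 9 * ln (real t + 1) \<le> lam t" for t
  proof (induction t)
    case 0
    show ?case using assms(1) by simp
  next
    case (Suc t)
    define a where "a = sqrt (real t)"
    have a: "0 \<le> a" "real t = a\<^sup>2" by (auto simp: a_def)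
    have "ln (real (Suc t) + 1) - ln (real t + 1) = ln ((real t + 2) / (real t + 1))"
      by (simp add: ln_div algebra_simps)
    also have "\<dots> \<le> (real t + 2) / (real t + 1) - 1" by (rule ln_le_minus_one) auto
    also have "\<dots> = 1 / (a\<^sup>2 + 1)" unfolding a(2) by (simp add: field_simps add_pos_nonneg add_nonneg_eq_0_iff)
    also have "\<dots> \<le> 9 / (a + 2)\<^sup>2"
    proof -
      have "9 * (a\<^sup>2 + 1) - (a + 2)\<^sup>2 = (2 * a - 1)\<^sup>2 + 4 * a\<^sup>2 + 4"
        by (simp add: power2_eq_square algebra_simps)
      then have "(a + 2)\<^sup>2 \<le> 9 * (a\<^sup>2 + 1)"
        using zero_le_power2[of "2 * a - 1"] zero_le_power2[of a] by linarith
      then show ?thesis using a by (simp add: field_simps add_pos_nonneg)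
    qed
    finally have "lam 0 / 9 * (ln (real (Suc t) + 1) - ln (real t + 1)) \<le> lam 0 / 9 * (9 / (a + 2)\<^sup>2)"
      using assms(1) by (intro mult_left_mono) auto
    with Suc.IH show ?case
      using assms(2)[of t] unfolding a_def[symmetric] by (simp add: algebra_simps)
  qed
  then show "\<forall>\<^sub>F t in sequentially. lam 0 / 9 * ln (real t + 1) \<le> lam t" by simp
  show "filterlim (\<lambda>t. lam 0 / 9 * ln (real t + 1)) at_top sequentially"
    using assms(1) by real_asymp
qed

section \<open>Descent along the iterates\<close>

locale split_cg_run = weights \<omega> for \<omega> :: "'i::finite \<Rightarrow> real" +
  fixes f :: "'a::real_inner \<Rightarrow> real"
    and L :: real
    and C :: "'i \<Rightarrow> 'a set"
    and \<gamma> lam :: "nat \<Rightarrow> real"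
    and X :: "nat \<Rightarrow> 'a ^ 'i"
  assumes L_pos: "0 < L"
    and convex_f: "convex_on UNIV f"
    and continuous_f: "\<And>x. isCont f x"
    and smooth_f: "smooth_with L f"
    and compact_C: "\<And>i. compact (C i)"
    and convex_C: "\<And>i. convex (C i)"
    and common_point: "(\<Inter>i. C i) \<noteq> {}"
    and step_size: "\<And>t. \<gamma> t = 2 / (sqrt (real t) + 2)"
    and penalty_pos: "0 < lam 0"
    and penalty_Suc: "\<And>t. lam (Suc t) = lam t + lam 0 / (sqrt (real t) + 2)\<^sup>2"
    and iterates: "split_cg \<omega> C f lam \<gamma> X"
begin

abbreviation F :: "nat \<Rightarrow> 'a ^ 'i \<Rightarrow> real" where
  "F t \<equiv> penalized \<omega> f (lam t)"

text \<open>
  The squared diameter of the product set in the weighted norm.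
\<close>

definition sq_diameter :: real where
  "sq_diameter = (\<Sum>i\<in>UNIV. \<omega> i * (diameter (C i))\<^sup>2)"

text \<open>
  The gap is measured against the infimum, which does not depend on a choice of minimizers.
\<close>

definition penalized_inf :: "nat \<Rightarrow> real" where
  "penalized_inf t = (INF x\<in>prod_set C. F t x)"

abbreviation gap :: "nat \<Rightarrow> real" where
  "gap t \<equiv> F t (X t) - penalized_inf t"

abbreviation fstar :: real where
  "fstar \<equiv> INF x\<in>(\<Inter>i. C i). f x"

lemma sq_diameter_nonneg: "0 \<le> sq_diameter"
  by (simp add: sq_diameter_def sum_nonneg weight_nonneg)

lemma penalty_Suc_ge: "lam t \<le> lam (Suc t)"
  using penalty_pos by (simp add: penalty_Suc)

lemma penalty_ge: "lam 0 \<le> lam t"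
proof (induction t)
  case (Suc t)
  then show ?case using penalty_Suc_ge[of t] by simp
qed simp

lemma penalty_nonneg: "0 \<le> lam t"
  using penalty_ge[of t] penalty_pos by simp

lemma step_bounds: "0 < \<gamma> t" "\<gamma> t \<le> 1"
  by (simp_all add: step_size add_nonneg_pos)

lemma weighted_dist_le_sq_diameter:
  assumes "x \<in> prod_set C" and "y \<in> prod_set C"
  shows "(\<Sum>i\<in>UNIV. \<omega> i * (norm (x $ i - y $ i))\<^sup>2) \<le> sq_diameter"
  unfolding sq_diameter_def
proof (intro sum_mono mult_left_mono power_mono weight_nonneg norm_ge_zero)
  fix i
  have "dist (x $ i) (y $ i) \<le> diameter (C i)"
    using assms by (intro diameter_bounded_bound compact_imp_bounded compact_C) (auto simp: prod_set_def)
  then show "norm (x $ i - y $ i) \<le> diameter (C i)" by (simp add: dist_norm)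
qed

lemma dist_average_le_sq_diameter:
  assumes "x \<in> prod_set C" and "c \<in> (\<Inter>i. C i)"
  shows "(dist_diagonal \<omega> x)\<^sup>2 + (norm (average \<omega> x - c))\<^sup>2 \<le> sq_diameter"
  using weighted_dist_le_sq_diameter[of x "\<chi> i. c"] assms
  by (simp add: prod_set_def dist_diagonal_sq_plus_average[symmetric])

lemma dist_diagonal_sq_le_sq_diameter:
  assumes "x \<in> prod_set C"
  shows "(dist_diagonal \<omega> x)\<^sup>2 \<le> sq_diameter"
proof -
  obtain c where "c \<in> (\<Inter>i. C i)" using common_point by blast
  from dist_average_le_sq_diameter[OF assms this] show ?thesis
    using zero_le_power2[of "norm (average \<omega> x - c)"] by linarith
qed

lemma iterate_in_prod: "X t \<in> prod_set C"
proof (induction t)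
  case 0
  show ?case using iterates by (simp add: split_cg_def)
next
  case (Suc t)
  have "X (Suc t) $ i \<in> C i" for i
  proof -
    obtain v where v: "v \<in> C i" and X: "X (Suc t) $ i = X t $ i + \<gamma> t *\<^sub>R (v - X t $ i)"
      using iterates unfolding split_cg_def is_arg_min_def by blast
    have "(1 - \<gamma> t) *\<^sub>R (X t $ i) + \<gamma> t *\<^sub>R v \<in> C i"
      using Suc step_bounds[of t] v by (intro convexD_alt[OF convex_C]) (auto simp: prod_set_def)
    then show ?thesis by (simp add: X algebra_simps)
  qed
  then show ?case by (simp add: prod_set_def)
qed

text \<open>
  The affine minorant of \<open>f\<close> at a common point is bounded below on the averages, which
  stay within a fixed distance of that point.
\<close>

lemma f_average_lower_bound: "\<exists>B. \<forall>x\<in>prod_set C. B \<le> f (average \<omega> x)"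
proof -
  obtain c where c: "c \<in> (\<Inter>i. C i)" using common_point by blast
  have "f c - norm (gradient f c) * sqrt sq_diameter \<le> f (average \<omega> x)" if x: "x \<in> prod_set C" for x
  proof -
    have "(norm (average \<omega> x - c))\<^sup>2 \<le> sq_diameter"
      using dist_average_le_sq_diameter[OF x c] zero_le_power2[of "dist_diagonal \<omega> x"] by linarith
    then have "norm (average \<omega> x - c) \<le> sqrt sq_diameter" by (rule real_le_rsqrt)
    then have "norm (gradient f c) * norm (average \<omega> x - c) \<le> norm (gradient f c) * sqrt sq_diameter"
      by (intro mult_left_mono) auto
    moreover have "- inner (gradient f c) (average \<omega> x - c)
        \<le> norm (gradient f c) * norm (average \<omega> x - c)"
      using Cauchy_Schwarz_ineq2[of "gradient f c" "average \<omega> x - c"] by linarith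
    ultimately show ?thesis
      using gradient_inequality[OF convex_f smooth_f, of c "average \<omega> x"] by linarith
  qed
  then show ?thesis by blast
qed

lemma f_average_le_F: "f (average \<omega> x) \<le> F t x"
  using penalty_nonneg[of t] by (simp add: penalized_def)

lemma bdd_below_F: "bdd_below (F t ` prod_set C)"
proof -
  obtain B where B: "\<forall>x\<in>prod_set C. B \<le> f (average \<omega> x)" using f_average_lower_bound by blast
  have "B \<le> F t x" if "x \<in> prod_set C" for x
    using B that f_average_le_F[of x t] by fastforce
  then show ?thesis unfolding bdd_below_def by blast
qed

lemma penalized_inf_le: "x \<in> prod_set C \<Longrightarrow> penalized_inf t \<le> F t x"
  unfolding penalized_inf_def by (rule cINF_lower[OF bdd_below_F])

lemma penalized_inf_greatest:
  assumes "\<And>x. x \<in> prod_set C \<Longrightarrow> b \<le> F t x"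
  shows "b \<le> penalized_inf t"
  unfolding penalized_inf_def using iterate_in_prod[of 0] assms by (intro cINF_greatest) auto

lemma gap_nonneg: "0 \<le> gap t"
  using penalized_inf_le[OF iterate_in_prod] by simp

lemma penalized_mono: "F t x \<le> F (Suc t) x"
  using penalty_Suc_ge[of t] by (auto simp: penalized_def intro!: mult_right_mono)

lemma penalized_inf_mono: "penalized_inf t \<le> penalized_inf (Suc t)"
proof (rule penalized_inf_greatest)
  fix x assume "x \<in> prod_set C"
  then show "penalized_inf t \<le> F (Suc t) x"
    using penalized_inf_le[of x t] penalized_mono[of t x] by linarith
qed

lemma bdd_below_feasible: "bdd_below (f ` (\<Inter>i. C i))"
proof -
  obtain B where B: "\<forall>x\<in>prod_set C. B \<le> f (average \<omega> x)" using f_average_lower_bound by blast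
  have "B \<le> f c" if "c \<in> (\<Inter>i. C i)" for c
    using B[rule_format, of "\<chi> i. c"] that by (simp add: average_diagonal prod_set_def)
  then show ?thesis unfolding bdd_below_def by blast
qed

lemma fstar_le: "c \<in> (\<Inter>i. C i) \<Longrightarrow> fstar \<le> f c"
  by (rule cINF_lower[OF bdd_below_feasible])

text \<open>
  On the diagonal the penalty vanishes, so every penalized problem is a relaxation of the
  minimization of \<open>f\<close> over the common points.
\<close>

lemma penalized_inf_le_fstar: "penalized_inf t \<le> fstar"
proof (rule cINF_greatest[OF common_point])
  fix c assume "c \<in> (\<Inter>i. C i)"
  then have "penalized_inf t \<le> F t (\<chi> i. c)"
    by (intro penalized_inf_le) (simp add: prod_set_def)
  then show "penalized_inf t \<le> f c"
    by (simp add: penalized_def average_diagonal dist_diagonal_constant)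
qed

text \<open>
  The oracle outputs together minimize the linearization of the penalized objective over the
  product set, so moving towards them decreases it at least as fast as moving towards \<open>z\<close>,
  and by convexity that decrease is at least the difference of values.
\<close>

lemma descent_step:
  assumes z: "z \<in> prod_set C"
  shows "F t (X (Suc t)) \<le> (1 - \<gamma> t) * F t (X t) + \<gamma> t * F t z + (L + lam t) / 2 * (\<gamma> t)\<^sup>2 * sq_diameter"
proof -
  let ?G = "\<lambda>i. gradient f (average \<omega> (X t)) + lam t *\<^sub>R (X t $ i - average \<omega> (X t))"
  have "\<forall>i. \<exists>v. is_arg_min (inner (?G i)) (\<lambda>z. z \<in> C i) v \<and>
      X (Suc t) $ i = X t $ i + \<gamma> t *\<^sub>R (v - X t $ i)"
    using iterates unfolding split_cg_def by blast
  then obtain v where v: "\<And>i. is_arg_min (inner (?G i)) (\<lambda>z. z \<in> C i) (v i)"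
    and X: "\<And>i. X (Suc t) $ i - X t $ i = \<gamma> t *\<^sub>R (v i - X t $ i)"
    by (metis add_diff_cancel_left')
  have v_le: "inner (?G i) (v i) \<le> inner (?G i) (z $ i)" for i
    using v[of i] z unfolding is_arg_min_def prod_set_def by (auto simp: not_less)
  have v_prod: "(\<chi> i. v i) \<in> prod_set C"
    using v by (simp add: is_arg_min_def prod_set_def)
  have lin: "(\<Sum>i\<in>UNIV. \<omega> i * inner (?G i) (X (Suc t) $ i - X t $ i))
      \<le> \<gamma> t * (F t z - F t (X t))"
  proof -
    have "(\<Sum>i\<in>UNIV. \<omega> i * inner (?G i) (X (Suc t) $ i - X t $ i))
        = \<gamma> t * (\<Sum>i\<in>UNIV. \<omega> i * inner (?G i) (v i - X t $ i))"
      by (simp add: X sum_distrib_left mult.left_commute)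
    also have "\<dots> \<le> \<gamma> t * (\<Sum>i\<in>UNIV. \<omega> i * inner (?G i) (z $ i - X t $ i))"
      using step_bounds[of t] v_le
      by (intro mult_left_mono sum_mono weight_nonneg) (auto simp: inner_diff_right)
    also have "\<dots> \<le> \<gamma> t * (F t z - F t (X t))"
      using step_bounds[of t] penalized_lower[OF convex_f smooth_f penalty_nonneg, of t "X t" z]
      by (intro mult_left_mono) auto
    finally show ?thesis .
  qed
  have "(\<Sum>i\<in>UNIV. \<omega> i * (norm (X (Suc t) $ i - X t $ i))\<^sup>2)
      = (\<gamma> t)\<^sup>2 * (\<Sum>i\<in>UNIV. \<omega> i * (norm ((\<chi> i. v i) $ i - X t $ i))\<^sup>2)"
    by (simp add: X power_mult_distrib sum_distrib_left mult.left_commute)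
  also have "\<dots> \<le> (\<gamma> t)\<^sup>2 * sq_diameter"
    by (intro mult_left_mono weighted_dist_le_sq_diameter v_prod iterate_in_prod) auto
  finally have "(L + lam t) / 2 * (\<Sum>i\<in>UNIV. \<omega> i * (norm (X (Suc t) $ i - X t $ i))\<^sup>2)
      \<le> (L + lam t) / 2 * ((\<gamma> t)\<^sup>2 * sq_diameter)"
    using L_pos penalty_nonneg[of t] by (intro mult_left_mono) auto
  with lin penalized_upper[OF smooth_f less_imp_le[OF L_pos] penalty_nonneg, of t "X (Suc t)" "X t"]
  have "F t (X (Suc t)) \<le> F t (X t) + \<gamma> t * (F t z - F t (X t))
      + (L + lam t) / 2 * ((\<gamma> t)\<^sup>2 * sq_diameter)"
    by linarith
  then show ?thesis by (simp add: algebra_simps)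
qed

text \<open>
  Besides the descent step, this accounts for the change of objective: the infimum grows with
  the penalty, while the value at the new iterate grows by a multiple of its squared distance to
  the diagonal.
\<close>

lemma gap_recurrence:
  "gap (Suc t) \<le> (1 - \<gamma> t) * gap t + (L + lam t) / 2 * (\<gamma> t)\<^sup>2 * sq_diameter
    + (lam (Suc t) - lam t) / 2 * sq_diameter"
proof -
  let ?E = "(L + lam t) / 2 * (\<gamma> t)\<^sup>2 * sq_diameter"
  \<comment> \<open>Solved for \<open>F t z\<close>, the descent step is a lower bound uniform in \<open>z\<close>.\<close>
  have "(F t (X (Suc t)) - (1 - \<gamma> t) * F t (X t) - ?E) / \<gamma> t \<le> penalized_inf t"
    using descent_step[of _ t] step_bounds[of t]
    by (intro penalized_inf_greatest) (auto simp: field_simps)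
  then have "F t (X (Suc t)) \<le> (1 - \<gamma> t) * F t (X t) + \<gamma> t * penalized_inf t + ?E"
    using step_bounds[of t] by (simp add: field_simps)
  moreover have "F (Suc t) (X (Suc t)) = F t (X (Suc t))
      + (lam (Suc t) - lam t) / 2 * (dist_diagonal \<omega> (X (Suc t)))\<^sup>2"
    by (simp add: penalized_def algebra_simps diff_divide_distrib)
  moreover have "(lam (Suc t) - lam t) / 2 * (dist_diagonal \<omega> (X (Suc t)))\<^sup>2
      \<le> (lam (Suc t) - lam t) / 2 * sq_diameter"
    using penalty_Suc_ge[of t] by (intro mult_left_mono dist_diagonal_sq_le_sq_diameter iterate_in_prod) auto
  ultimately show ?thesis
    using penalized_inf_mono[of t] by (simp add: algebra_simps add_divide_distrib diff_divide_distrib)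
qed

text \<open>
  The constant \<open>1 / 4\<close> absorbs the penalty increment in \<open>gap_recurrence\<close>: the two
  error terms add up to \<open>2 (L + \<lambda>\<^sub>t + \<lambda>\<^sub>0 / 4) / (sqrt t + 2)\<^sup>2\<close> times the squared diameter.
\<close>

definition rate_numerator :: "nat \<Rightarrow> real" where
  "rate_numerator t = lam 0 * (2 * ln (sqrt (real t) + 2) + 1 / 4) + L"

lemma rate_numerator_nonneg: "0 \<le> rate_numerator t"
  using penalty_pos L_pos by (simp add: rate_numerator_def)

lemma rate_numerator_mono: "rate_numerator t \<le> rate_numerator (Suc t)"
  using penalty_pos by (simp add: rate_numerator_def add_nonneg_pos)

lemma gap_recurrence_explicit:
  defines "s t \<equiv> sqrt (real t) + 2"
  shows "gap (Suc t) \<le> (1 - 2 / s t) * gap t + 2 * sq_diameter * (rate_numerator t / (s t)\<^sup>2)"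
proof -
  have s: "0 < s t" by (simp add: s_def add_nonneg_pos)
  have "(L + lam t) / 2 * (\<gamma> t)\<^sup>2 + (lam (Suc t) - lam t) / 2
      = 2 * ((L + lam t + lam 0 / 4) / (s t)\<^sup>2)"
    using s by (simp add: step_size penalty_Suc s_def[symmetric] power_divide field_simps)
  also have "\<dots> \<le> 2 * (rate_numerator t / (s t)\<^sup>2)"
    using penalty_le_ln[of lam t] penalty_pos penalty_Suc
    by (intro mult_left_mono divide_right_mono) (auto simp: rate_numerator_def algebra_simps)
  finally have "((L + lam t) / 2 * (\<gamma> t)\<^sup>2 + (lam (Suc t) - lam t) / 2) * sq_diameter
      \<le> 2 * (rate_numerator t / (s t)\<^sup>2) * sq_diameter"
    using sq_diameter_nonneg by (rule mult_right_mono)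
  with gap_recurrence[of t] show ?thesis
    by (simp add: step_size s_def algebra_simps)
qed

text \<open>
  At \<open>t = 0\<close> the step size is 1, so the recurrence bounds the gap at time 1 whatever the
  starting point is.
\<close>

lemma gap_bound: "gap (Suc t) \<le> 2 * sq_diameter * (rate_numerator (Suc t) / (sqrt (real (Suc t)) + 2))"
proof (induction t)
  case 0
  have "rate_numerator 0 / 4 \<le> rate_numerator (Suc 0) / 3"
    using rate_numerator_mono[of 0] rate_numerator_nonneg[of 0] by simp
  then have "2 * sq_diameter * (rate_numerator 0 / 4) \<le> 2 * sq_diameter * (rate_numerator (Suc 0) / 3)"
    using sq_diameter_nonneg by (intro mult_left_mono) auto
  then show ?case using gap_recurrence_explicit[of 0] by simp
next
  case (Suc t)
  let ?n = "Suc t"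
  define s where "s = sqrt (real ?n) + 2"
  define s' where "s' = sqrt (real (Suc ?n)) + 2"
  have s: "2 < s" "0 < s'" by (auto simp: s_def s'_def add_nonneg_pos)
  have "sqrt (real (Suc ?n)) \<le> sqrt (real ?n) + 1"
    by (rule real_le_lsqrt) (auto simp: power2_sum)
  then have s's: "s' \<le> s + 1" by (simp add: s_def s'_def)
  have "gap (Suc ?n) \<le> (1 - 2 / s) * gap ?n + 2 * sq_diameter * (rate_numerator ?n / s\<^sup>2)"
    unfolding s_def by (rule gap_recurrence_explicit)
  also have "\<dots> \<le> (1 - 2 / s) * (2 * sq_diameter * (rate_numerator ?n / s)) + 2 * sq_diameter * (rate_numerator ?n / s\<^sup>2)"
    using s by (intro add_right_mono mult_left_mono Suc.IH[folded s_def]) simp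
  also have "\<dots> = 2 * sq_diameter * (rate_numerator ?n * ((s - 1) / s\<^sup>2))"
    using s by (simp add: field_simps power2_eq_square)
  also have "\<dots> \<le> 2 * sq_diameter * (rate_numerator (Suc ?n) * (1 / s'))"
  proof (intro mult_left_mono mult_mono rate_numerator_mono rate_numerator_nonneg)
    have "(s - 1) * s' \<le> (s - 1) * (s + 1)" using s s's by (intro mult_left_mono) auto
    also have "\<dots> \<le> s\<^sup>2" by (simp add: algebra_simps power2_eq_square)
    finally show "(s - 1) / s\<^sup>2 \<le> 1 / s'" using s by (simp add: field_simps)
  qed (use s sq_diameter_nonneg in auto)
  finally show ?case by (simp add: s'_def)
qed

section \<open>Convergence to a common point\<close>

lemma gap_tendsto_0: "gap \<longlonglongrightarrow> 0"
proof -
  have "(\<lambda>t. 2 * sq_diameter * (rate_numerator t / (sqrt (real t) + 2))) \<longlonglongrightarrow> 0"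
  proof -
    have "(\<lambda>t. ln (sqrt (real t) + 2) / (sqrt (real t) + 2)) \<longlonglongrightarrow> 0" by real_asymp
    moreover have "(\<lambda>t. 1 / (sqrt (real t) + 2)) \<longlonglongrightarrow> 0" by real_asymp
    ultimately have "(\<lambda>t. 2 * sq_diameter * (2 * lam 0 * (ln (sqrt (real t) + 2) / (sqrt (real t) + 2))
        + (lam 0 / 4 + L) * (1 / (sqrt (real t) + 2)))) \<longlonglongrightarrow> 2 * sq_diameter * (2 * lam 0 * 0 + (lam 0 / 4 + L) * 0)"
      by (intro tendsto_intros)
    moreover have "rate_numerator t / (sqrt (real t) + 2)
        = 2 * lam 0 * (ln (sqrt (real t) + 2) / (sqrt (real t) + 2))
          + (lam 0 / 4 + L) * (1 / (sqrt (real t) + 2))" for t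
      by (simp add: rate_numerator_def algebra_simps add_divide_distrib)
    ultimately show ?thesis by simp
  qed
  then have "(\<lambda>t. 2 * sq_diameter * (rate_numerator (Suc t) / (sqrt (real (Suc t)) + 2))) \<longlonglongrightarrow> 0"
    by (rule LIMSEQ_Suc)
  then have "(\<lambda>t. gap (Suc t)) \<longlonglongrightarrow> 0"
    by (rule real_tendsto_sandwich[rotated 2, OF tendsto_const])
       (intro always_eventually allI gap_nonneg gap_bound)+
  then show ?thesis by (rule LIMSEQ_imp_Suc)
qed

lemma F_le_fstar_plus_gap: "F t (X t) \<le> fstar + gap t"
  using penalized_inf_le_fstar[of t] by simp

text \<open>
  The penalty term of the iterates stays bounded while its coefficient tends to infinity.
\<close>

lemma dist_diagonal_tendsto_0: "(\<lambda>t. dist_diagonal \<omega> (X t)) \<longlonglongrightarrow> 0"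
proof -
  obtain B where B: "\<forall>x\<in>prod_set C. B \<le> f (average \<omega> x)" using f_average_lower_bound by blast
  have le: "(dist_diagonal \<omega> (X t))\<^sup>2 \<le> 2 * (fstar - B + gap t) / lam t" for t
  proof -
    have "B \<le> f (average \<omega> (X t))" using B iterate_in_prod by blast
    then have "lam t / 2 * (dist_diagonal \<omega> (X t))\<^sup>2 \<le> fstar - B + gap t"
      using F_le_fstar_plus_gap[of t] unfolding penalized_def by linarith
    then show ?thesis using penalty_ge[of t] penalty_pos by (simp add: field_simps)
  qed
  have "filterlim lam at_top sequentially"
    by (rule penalty_at_top[OF penalty_pos penalty_Suc])
  then have "(\<lambda>t. 2 * (fstar - B + gap t) / lam t) \<longlonglongrightarrow> 0"
    by (intro real_tendsto_divide_at_top[where c="2 * (fstar - B + 0)"] tendsto_intros gap_tendsto_0)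
  then have "(\<lambda>t. (dist_diagonal \<omega> (X t))\<^sup>2) \<longlonglongrightarrow> 0"
    by (rule real_tendsto_sandwich[rotated 2, OF tendsto_const]) (intro always_eventually allI le zero_le_power2)+
  then show ?thesis by (simp add: power_tendsto_0_iff)
qed

text \<open>
  The components share their limits because they all stay close to the average; compactness of a
  single \<open>C j\<close> then suffices to extract a limit of the whole iterate.
\<close>

lemma cluster_feasible:
  assumes r: "strict_mono r" and lim: "(\<lambda>k. X (r k) $ j) \<longlonglongrightarrow> c"
  shows "c \<in> (\<Inter>i. C i)" and "(\<lambda>k. average \<omega> (X (r k))) \<longlonglongrightarrow> c"
    and "(\<lambda>k. X (r k) $ i) \<longlonglongrightarrow> c"
proof -
  have dev: "(\<lambda>k. X (r k) $ i - average \<omega> (X (r k))) \<longlonglongrightarrow> 0" for i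
  proof (rule Lim_null_comparison)
    show "\<forall>\<^sub>F k in sequentially. norm (X (r k) $ i - average \<omega> (X (r k)))
        \<le> dist_diagonal \<omega> (X (r k)) / sqrt (\<omega> i)"
      by (simp add: component_deviation_le)
    have "(\<lambda>k. dist_diagonal \<omega> (X (r k))) \<longlonglongrightarrow> 0"
      using LIMSEQ_subseq_LIMSEQ[OF dist_diagonal_tendsto_0 r] by (simp add: o_def)
    from tendsto_divide[OF this tendsto_const, of "sqrt (\<omega> i)"]
    show "(\<lambda>k. dist_diagonal \<omega> (X (r k)) / sqrt (\<omega> i)) \<longlonglongrightarrow> 0"
      using weight_pos[of i] by simp
  qed
  show avg: "(\<lambda>k. average \<omega> (X (r k))) \<longlonglongrightarrow> c"
    using tendsto_diff[OF lim dev[of j]] by simp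
  show all: "(\<lambda>k. X (r k) $ i) \<longlonglongrightarrow> c" for i
    using tendsto_add[OF avg dev[of i]] by simp
  have "c \<in> C i" for i
    by (rule closed_sequentially[OF compact_imp_closed[OF compact_C] _ all[of i]])
       (use iterate_in_prod in \<open>simp add: prod_set_def\<close>)
  then show "c \<in> (\<Inter>i. C i)" by blast
qed

lemma f_average_tendsto:
  assumes "(\<lambda>k. average \<omega> (X (r k))) \<longlonglongrightarrow> c"
  shows "(\<lambda>k. f (average \<omega> (X (r k)))) \<longlonglongrightarrow> f c"
  using continuous_f assms by (rule isCont_tendsto_compose)

text \<open>
  Otherwise a subsequence with values at most \<open>e\<close> would have a feasible cluster point,
  whose value is at least the optimal one.
\<close>

lemma eventually_f_average_gt:
  assumes "e < fstar"
  shows "\<forall>\<^sub>F t in sequentially. e < f (average \<omega> (X t))"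
proof (rule ccontr)
  assume "\<not> ?thesis"
  then obtain r :: "nat \<Rightarrow> nat" where r: "strict_mono r"
    and le: "\<And>k. f (average \<omega> (X (r k))) \<le> e"
    using not_eventually_sequentiallyD by (metis linorder_not_less)
  obtain j :: 'i where True by simp
  have "\<forall>k. X (r k) $ j \<in> C j" using iterate_in_prod by (simp add: prod_set_def)
  then obtain c q where q: "strict_mono q" and lim: "((\<lambda>k. X (r k) $ j) \<circ> q) \<longlonglongrightarrow> c"
    using compact_C[of j] unfolding compact_def by metis
  have rq: "strict_mono (r \<circ> q)" using r q by (rule strict_mono_o)
  have lim': "(\<lambda>k. X ((r \<circ> q) k) $ j) \<longlonglongrightarrow> c" using lim by (simp add: o_def)
  have "(\<lambda>k. f (average \<omega> (X ((r \<circ> q) k)))) \<longlonglongrightarrow> f c"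
    by (rule f_average_tendsto[OF cluster_feasible(2)[OF rq lim']])
  then have "f c \<le> e"
    by (rule tendsto_upperbound) (use le in simp_all)
  with fstar_le[OF cluster_feasible(1)[OF rq lim']] assms show False by linarith
qed

lemma F_tendsto_fstar: "(\<lambda>t. F t (X t)) \<longlonglongrightarrow> fstar"
proof (rule order_tendstoI)
  fix a assume "a < fstar"
  from eventually_f_average_gt[OF this] show "\<forall>\<^sub>F t in sequentially. a < F t (X t)"
    by (rule eventually_mono) (use f_average_le_F less_le_trans in blast)
next
  fix a assume "fstar < a"
  moreover have "(\<lambda>t. fstar + gap t) \<longlonglongrightarrow> fstar"
    using tendsto_add[OF tendsto_const gap_tendsto_0] by simp
  ultimately have "\<forall>\<^sub>F t in sequentially. fstar + gap t < a" by (simp only: order_tendstoD)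
  then show "\<forall>\<^sub>F t in sequentially. F t (X t) < a"
    by (rule eventually_mono) (use F_le_fstar_plus_gap le_less_trans in blast)
qed

lemma accumulation_point_optimal:
  assumes "accumulation_point \<omega> X z"
  shows "average \<omega> z \<in> (\<Inter>i. C i) \<and> f (average \<omega> z) = fstar"
proof -
  obtain r :: "nat \<Rightarrow> nat" where r: "strict_mono r"
    and lim0: "(\<lambda>k. wnorm \<omega> (X (r k) - z)) \<longlonglongrightarrow> 0"
    using assms unfolding accumulation_point_def by blast
  have comp: "(\<lambda>k. X (r k) $ i) \<longlonglongrightarrow> z $ i" for i
  proof -
    have "(\<lambda>k. X (r k) $ i - z $ i) \<longlonglongrightarrow> 0"
    proof (rule Lim_null_comparison)
      show "\<forall>\<^sub>F k in sequentially. norm (X (r k) $ i - z $ i) \<le> wnorm \<omega> (X (r k) - z) / sqrt (\<omega> i)"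
        using component_le_wnorm[of "X (r _) - z" i] by simp
      from tendsto_divide[OF lim0 tendsto_const, of "sqrt (\<omega> i)"]
      show "(\<lambda>k. wnorm \<omega> (X (r k) - z) / sqrt (\<omega> i)) \<longlonglongrightarrow> 0"
        using weight_pos[of i] by simp
    qed
    then show ?thesis by (simp add: LIM_zero_iff)
  qed
  obtain j :: 'i where True by simp
  have "z $ i = z $ j" for i
    using LIMSEQ_unique[OF comp cluster_feasible(3)[OF r comp[of j]]] .
  then have "z = (\<chi> i. z $ j)" by (simp add: vec_eq_iff)
  then have zj: "average \<omega> z = z $ j" by (metis average_diagonal)
  have feas: "average \<omega> z \<in> (\<Inter>i. C i)" unfolding zj by (rule cluster_feasible(1)[OF r comp])
  have "(\<lambda>k. f (average \<omega> (X (r k)))) \<longlonglongrightarrow> f (average \<omega> z)"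
    unfolding zj by (rule f_average_tendsto[OF cluster_feasible(2)[OF r comp]])
  moreover have "(\<lambda>k. F (r k) (X (r k))) \<longlonglongrightarrow> fstar"
    using LIMSEQ_subseq_LIMSEQ[OF F_tendsto_fstar r] by (simp add: o_def)
  ultimately have "f (average \<omega> z) \<le> fstar"
    by (rule LIMSEQ_le) (use f_average_le_F in blast)
  with feas fstar_le show ?thesis by (meson antisym)
qed

lemma penalized_inf_eq:
  assumes "is_arg_min (F t) (\<lambda>x. x \<in> prod_set C) xstar"
  shows "penalized_inf t = F t xstar"
  using assms unfolding is_arg_min_def
  by (intro antisym penalized_inf_le penalized_inf_greatest) (auto simp: not_less)

end

section \<open>The convergence theorem\<close>

(* The upper bound is asserted for t \<ge> 1 only: at t = 0 it is false, since it does not involve the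
   size of the gradient of f while x_0 is arbitrary. Counterexample: a single set C = [0,1] in the
   real line, f(x) = 100 x, L = lambda_0 = 1, x_0 = 1, for which H_0 = 100 while the bound would give less than 5. *)

theorem theorem3p3:
  fixes \<omega> :: "'i::finite \<Rightarrow> real"
    and f :: "'a::{real_inner, complete_space} \<Rightarrow> real"
    and L :: real
    and C :: "'i \<Rightarrow> 'a set"
    and \<gamma> lam :: "nat \<Rightarrow> real"
    and X :: "nat \<Rightarrow> 'a ^ 'i"
  assumes "\<And>i. 0 < \<omega> i" and "\<And>i. \<omega> i \<le> 1" and "(\<Sum>i\<in>UNIV. \<omega> i) = 1"
    and "0 < L"
    and "convex_on UNIV f"
    and "\<And>x. f differentiable (at x)"
    and "smooth_with L f"
    and "\<And>i. C i \<noteq> {}" and "\<And>i. compact (C i)" and "\<And>i. convex (C i)"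
    and "(\<Inter>i. C i) \<noteq> {}"
    and "\<And>t. \<gamma> t = 2 / (sqrt (real t) + 2)"
    and "0 < lam 0"
    and "\<And>t. lam (Suc t) = lam t + lam 0 / (sqrt (real t) + 2)\<^sup>2"
    and "split_cg \<omega> C f lam \<gamma> X"
  shows
    "(\<forall>t xstar. is_arg_min (penalized \<omega> f (lam t)) (\<lambda>x. x \<in> prod_set C) xstar \<longrightarrow>
        0 \<le> penalized \<omega> f (lam t) (X t) - penalized \<omega> f (lam t) xstar \<and>
        (1 \<le> t \<longrightarrow>
          penalized \<omega> f (lam t) (X t) - penalized \<omega> f (lam t) xstar
          \<le> 2 * (\<Sum>i\<in>UNIV. \<omega> i * (diameter (C i))\<^sup>2) *
              ((lam 0 * (2 * ln (sqrt (real t) + 2) + 1 / 4) + L) / (sqrt (real t) + 2)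
               + 4 * lam 0 / (sqrt (real t) + 2)\<^sup>2))) \<and>
     (\<lambda>t. penalized \<omega> f (lam t) (X t)) \<longlonglongrightarrow> (INF x\<in>(\<Inter>i. C i). f x) \<and>
     (\<lambda>t. dist_diagonal \<omega> (X t)) \<longlonglongrightarrow> 0 \<and>
     (\<forall>xinf. accumulation_point \<omega> X xinf \<longrightarrow>
        average \<omega> xinf \<in> (\<Inter>i. C i) \<and>
        f (average \<omega> xinf) = (INF x\<in>(\<Inter>i. C i). f x))"
proof -
  interpret split_cg_run \<omega> f L C \<gamma> lam X
  proof unfold_locales
    show "isCont f x" for x by (rule differentiable_imp_continuous_within) (rule assms)
  qed (fact assms)+
  have bound: "gap t \<le> 2 * sq_diameter * (rate_numerator t / (sqrt (real t) + 2)
      + 4 * lam 0 / (sqrt (real t) + 2)\<^sup>2)" if "1 \<le> t" for t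
  proof -
    have "gap t \<le> 2 * sq_diameter * (rate_numerator t / (sqrt (real t) + 2))"
      using gap_bound[of "t - 1"] that by simp
    also have "\<dots> \<le> 2 * sq_diameter * (rate_numerator t / (sqrt (real t) + 2)
        + 4 * lam 0 / (sqrt (real t) + 2)\<^sup>2)"
      using sq_diameter_nonneg penalty_pos by (intro mult_left_mono) auto
    finally show ?thesis .
  qed
  show ?thesis
    using gap_nonneg bound[unfolded sq_diameter_def rate_numerator_def] F_tendsto_fstar
      dist_diagonal_tendsto_0 accumulation_point_optimal
    by (simp add: penalized_inf_eq[symmetric])
qed

end
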